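(* Let $n\ge2$ be an integer and let $\boldsymbol p=(p_1,p_2,\ldots)\in\mathbb{R}^{\mathbb{N}}$ be a probability distribution on $\mathbb{N}$. Put $$\alpha_n=2\sum_{j:\,p_j<1/n}p_j,\qquad \beta_n=\frac1{\sqrt n}\sum_{j:\,p_j\ge1/n}\sqrt{p_j}.$$ Let $X_1,\ldots,X_n$ be independent random variables, each distributed according to $\boldsymbol p$, and let $J_n=\sum_{j\in\mathbb{N}}\left|\hat p^{(n)}_j-p_j\right|$, where $\hat p^{(n)}_j$ is the empirical frequency of $j$. Then $$\mathbb{E}J_n\ge\frac{\alpha_n+\beta_n}{4}-\frac1{\sqrt n}.$$
   Context: $\mathbb{N}=\{1,2,\ldots\}$. A distribution $\boldsymbol p\in\mathbb{R}^{\mathbb{N}}$ is a sequence of nonnegative entries summing to $1$. The empirical frequencies are $\hat p^{(n)}_j=\frac1n\sum_{i=1}^n\mathbf 1_{\{X_i=j\}}$, $j\in\mathbb{N}$. *)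

theory Defs
  imports "HOL-Probability.Probability"
begin

text \<open>
  The index set of all sequences and sums is \<open>{1,2,\<dots>}\<close>, i.e. \<open>{1..}\<close> in type \<^typ>\<open>nat\<close>; the value of a
  sequence at \<open>0\<close> is irrelevant throughout.
\<close>

definition distribution :: "(nat \<Rightarrow> real) \<Rightarrow> bool" where
  "distribution p \<longleftrightarrow> (\<forall>j\<in>{1..}. 0 \<le> p j) \<and> (p has_sum 1) {1..}"

definition alpha :: "nat \<Rightarrow> (nat \<Rightarrow> real) \<Rightarrow> real" where
  "alpha n p = 2 * (\<Sum>\<^sub>\<infinity>j\<in>{j\<in>{1..}. p j < 1 / real n}. p j)"

text \<open>For a distribution the index set below is finite if \<open>n > 0\<close>, so this is an ordinary sum.\<close>

definition beta :: "nat \<Rightarrow> (nat \<Rightarrow> real) \<Rightarrow> real" where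
  "beta n p = 1 / sqrt (real n) * (\<Sum>\<^sub>\<infinity>j\<in>{j\<in>{1..}. p j \<ge> 1 / real n}. sqrt (p j))"

definition emp_freq :: "nat \<Rightarrow> (nat \<Rightarrow> 'a \<Rightarrow> nat) \<Rightarrow> 'a \<Rightarrow> nat \<Rightarrow> real" where
  "emp_freq n X \<omega> j = 1 / real n * (\<Sum>i=1..n. indicator {\<omega>'. X i \<omega>' = j} \<omega>)"

definition J :: "nat \<Rightarrow> (nat \<Rightarrow> real) \<Rightarrow> (nat \<Rightarrow> 'a \<Rightarrow> nat) \<Rightarrow> 'a \<Rightarrow> real" where
  "J n p X \<omega> = (\<Sum>\<^sub>\<infinity>j\<in>{1..}. \<bar>emp_freq n X \<omega> j - p j\<bar>)"

end

theory Submission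
  imports Defs
begin

text \<open>
  Fix \<open>j\<close>, write \<open>q = p j\<close>, and let \<open>Y\<close> be the number of \<open>i\<close> with \<open>X i = j\<close>, a binomial variable with
  mean \<open>n q\<close>.

  If \<open>q < 1/n\<close>, the event \<open>Y = 0\<close> alone gives \<open>E \<bar>Y - n q\<bar> \<ge> 2 n q (1 - q)^n \<ge> n q / 2\<close>.

  If \<open>q \<ge> 1/n\<close>, the second moment \<open>n q (1 - q)\<close> and the fourth moment, at most \<open>4 (n q)^2\<close>, of
  \<open>Z = Y - n q\<close> are inserted into \<open>\<bar>z\<bar> \<ge> 3 z^2 / (2 t) - z^4 / (2 t^3)\<close> with \<open>t = 2 sqrt (n q)\<close>. This gives
  \<open>E \<bar>Z\<bar> \<ge> sqrt (n q) (1/2 - 3 q / 4) \<ge> sqrt (n q) (1/4 - sqrt q)\<close>, and after division by \<open>n\<close> the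
  losses \<open>q / sqrt n\<close> add up to at most \<open>1 / sqrt n\<close>.
\<close>

section \<open>Moments of sums of bounded independent centred variables\<close>

lemma (in prob_space) bounded_integrable:
  fixes f :: "'a \<Rightarrow> real"
  assumes "random_variable borel f" "\<And>\<omega>. \<bar>f \<omega>\<bar> \<le> c"
  shows "integrable M f"
  using assms by (intro integrable_const_bound[where B = c]) auto

text \<open>Induction on \<open>I\<close>: the new variable is independent of the sum of the others,
  so mixed moments factor and every term with a centred first power vanishes. The mean is carried
  along because the factor \<open>expectation S = 0\<close> removes the term with
  \<open>Z i \<omega> ^ 3 * S \<omega>\<close>. The bound 1 makes all powers integrable and gives a
  fourth moment of at most \<open>v\<close> for each summand.\<close>

lemma (in prob_space) moments_sum_centered:
  fixes Z :: "'i \<Rightarrow> 'a \<Rightarrow> real" and v :: real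
  assumes "finite I" "indep_vars (\<lambda>_. borel) Z I"
    and "\<And>i \<omega>. i \<in> I \<Longrightarrow> \<bar>Z i \<omega>\<bar> \<le> 1"
    and "\<And>i. i \<in> I \<Longrightarrow> expectation (Z i) = 0"
    and "\<And>i. i \<in> I \<Longrightarrow> expectation (\<lambda>\<omega>. Z i \<omega> ^ 2) = v"
  shows "expectation (\<lambda>\<omega>. \<Sum>i\<in>I. Z i \<omega>) = 0 \<and>
    expectation (\<lambda>\<omega>. (\<Sum>i\<in>I. Z i \<omega>) ^ 2) = card I * v \<and>
    expectation (\<lambda>\<omega>. (\<Sum>i\<in>I. Z i \<omega>) ^ 4) \<le> 3 * (card I * v) ^ 2 + card I * v"
  using assms
proof (induction I rule: finite_induct)
  case empty
  then show ?case by simp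
next
  case (insert i I)
  define S where "S = (\<lambda>\<omega>. \<Sum>i\<in>I. Z i \<omega>)"
  define V where "V = card I * v"
  have "indep_vars (\<lambda>_. borel) Z I"
    using insert.prems(1) by (rule indep_vars_subset) auto
  then have IH: "expectation S = 0" "expectation (\<lambda>\<omega>. S \<omega> ^ 2) = V"
    "expectation (\<lambda>\<omega>. S \<omega> ^ 4) \<le> 3 * V ^ 2 + V"
    using insert.IH insert.prems by (auto simp: S_def V_def)
  have mZ[measurable]: "random_variable borel (Z i)"
    using insert.prems(1) by (simp add: indep_vars_def)
  have "\<And>k. k \<in> I \<Longrightarrow> random_variable borel (Z k)"
    using insert.prems(1) by (simp add: indep_vars_def)
  then have mS[measurable]: "random_variable borel S"
    unfolding S_def by simp
  have Z1: "\<bar>Z i \<omega>\<bar> \<le> 1" for \<omega>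
    using insert.prems(2) by simp
  have S1: "\<bar>S \<omega>\<bar> \<le> card I" for \<omega>
  proof -
    have "\<bar>S \<omega>\<bar> \<le> (\<Sum>k\<in>I. \<bar>Z k \<omega>\<bar>)" unfolding S_def by (rule sum_abs)
    also have "\<dots> \<le> (\<Sum>k\<in>I. 1)" using insert.prems(2) by (intro sum_mono) auto
    finally show ?thesis by simp
  qed
  have iZ: "integrable M (\<lambda>\<omega>. Z i \<omega> ^ a)" for a
    using Z1 by (intro bounded_integrable[where c = 1]) (auto simp: power_abs power_le_one)
  have iS: "integrable M (\<lambda>\<omega>. S \<omega> ^ b)" for b
    using S1 by (intro bounded_integrable[where c = "card I ^ b"]) (auto simp: power_abs power_mono)
  have ind: "indep_var borel (\<lambda>\<omega>. Z i \<omega> ^ a) borel (\<lambda>\<omega>. S \<omega> ^ b)" for a b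
    using indep_var_compose[OF indep_vars_sum[OF insert.hyps insert.prems(1)],
        of "\<lambda>x. x ^ a" borel "\<lambda>x. x ^ b" borel]
    by (simp add: comp_def S_def)
  have prod: "integrable M (\<lambda>\<omega>. Z i \<omega> ^ a * S \<omega> ^ b)"
    "expectation (\<lambda>\<omega>. Z i \<omega> ^ a * S \<omega> ^ b) =
      expectation (\<lambda>\<omega>. Z i \<omega> ^ a) * expectation (\<lambda>\<omega>. S \<omega> ^ b)" for a b
    using indep_var_integrable[OF ind iZ iS] indep_var_lebesgue_integral[OF ind iZ iS] by auto
  note p11 = prod[of 1 1, simplified] and p13 = prod[of 1 3, simplified]
    and p31 = prod[of 3 1, simplified] and p22 = prod[of 2 2]
  have EZ: "expectation (Z i) = 0" "expectation (\<lambda>\<omega>. Z i \<omega> ^ 2) = v"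
    using insert.prems by auto
  have "expectation (\<lambda>\<omega>. Z i \<omega> ^ 4) \<le> expectation (\<lambda>\<omega>. Z i \<omega> ^ 2)"
  proof (rule integral_mono[OF iZ iZ])
    fix \<omega>
    have "(Z i \<omega>)\<^sup>2 * (Z i \<omega>)\<^sup>2 \<le> (Z i \<omega>)\<^sup>2 * 1"
      using Z1[of \<omega>] by (intro mult_left_mono) (auto simp: abs_square_le_1)
    then show "Z i \<omega> ^ 4 \<le> Z i \<omega> ^ 2" by (simp flip: power_add)
  qed
  then have Z4: "expectation (\<lambda>\<omega>. Z i \<omega> ^ 4) \<le> v" using EZ by simp
  have e1: "expectation (\<lambda>\<omega>. Z i \<omega> + S \<omega>) = 0"
    using iZ[of 1] iS[of 1] EZ IH by simp
  have "expectation (\<lambda>\<omega>. (Z i \<omega> + S \<omega>) ^ 2) =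
    expectation (\<lambda>\<omega>. Z i \<omega> ^ 2 + (2 * (Z i \<omega> * S \<omega>) + S \<omega> ^ 2))"
    by (simp add: power2_sum algebra_simps)
  also have "\<dots> = V + v"
    using p11 iZ[of 2] iS[of 2] EZ IH by simp
  finally have e2: "expectation (\<lambda>\<omega>. (Z i \<omega> + S \<omega>) ^ 2) = V + v" .
  \<comment> \<open>Binomial expansion; of the three mixed terms only
    \<open>6 * Z i \<omega> ^ 2 * S \<omega> ^ 2\<close> survives the expectation.\<close>
  have "expectation (\<lambda>\<omega>. (Z i \<omega> + S \<omega>) ^ 4) =
    expectation (\<lambda>\<omega>. Z i \<omega> ^ 4 + (4 * (Z i \<omega> ^ 3 * S \<omega>) + (6 * (Z i \<omega> ^ 2 * S \<omega> ^ 2) +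
      (4 * (Z i \<omega> * S \<omega> ^ 3) + S \<omega> ^ 4))))"
    by (rule Bochner_Integration.integral_cong) (auto simp: power4_eq_xxxx power3_eq_cube power2_eq_square algebra_simps)
  also have "\<dots> = expectation (\<lambda>\<omega>. Z i \<omega> ^ 4) + 6 * v * V + expectation (\<lambda>\<omega>. S \<omega> ^ 4)"
    using p13 p31 p22 iZ[of 4] iS[of 4] EZ IH by simp
  also have "\<dots> \<le> v + 6 * v * V + (3 * V ^ 2 + V)"
    using Z4 IH(3) by simp
  \<comment> \<open>The right side exceeds the left by exactly \<open>3 * v ^ 2\<close>.\<close>
  also have "\<dots> \<le> 3 * (V + v) ^ 2 + (V + v)"
    by (simp add: power2_sum algebra_simps)
  finally have e4: "expectation (\<lambda>\<omega>. (Z i \<omega> + S \<omega>) ^ 4) \<le> 3 * (V + v) ^ 2 + (V + v)" .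
  have "card (insert i I) * v = V + v"
    using insert.hyps by (simp add: V_def algebra_simps)
  moreover have "(\<Sum>k\<in>insert i I. Z k \<omega>) = Z i \<omega> + S \<omega>" for \<omega>
    using insert.hyps by (simp add: S_def)
  ultimately show ?case using e1 e2 e4 by simp
qed

section \<open>Mean absolute deviation of a Bernoulli sum\<close>

lemma abs_ge_quartic:
  fixes z t :: real
  assumes "t > 0"
  shows "3 * z\<^sup>2 / (2 * t) - z ^ 4 / (2 * t ^ 3) \<le> \<bar>z\<bar>"
proof -
  \<comment> \<open>Scaling by \<open>t\<close> reduces the claim to
    \<open>3 * u ^ 2 - u ^ 4 \<le> 2 * u\<close>. The difference factors as
    \<open>u * (u - 1) ^ 2 * (u + 2)\<close>; the double root at 1 means equality at
    \<open>\<bar>z\<bar> = t\<close>.\<close>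
  define u where "u = \<bar>z\<bar> / t"
  have u: "u \<ge> 0" "\<bar>z\<bar> = t * u" using assms by (auto simp: u_def)
  have "0 \<le> u * (u - 1)\<^sup>2 * (u + 2)" using u by simp
  also have "\<dots> = 2 * u - 3 * u\<^sup>2 + u ^ 4"
    by (simp add: power2_eq_square power4_eq_xxxx algebra_simps)
  finally have "t * ((3 * u\<^sup>2 - u ^ 4) / 2) \<le> t * u"
    using assms by (intro mult_left_mono) auto
  moreover have "z\<^sup>2 = t\<^sup>2 * u\<^sup>2" "z ^ 4 = t ^ 4 * u ^ 4"
    using u(2) power_even_abs[of 2 z] power_even_abs[of 4 z]
    by (auto simp flip: power_mult_distrib)
  ultimately show ?thesis
    using assms u by (simp add: field_simps power2_eq_square power4_eq_xxxx power3_eq_cube)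
qed

text \<open>The first bound comes from the event without successes and serves small means; the
  second compares the second and fourth moments and serves means of at least 1.\<close>

lemma (in prob_space) Bernoulli_sum_abs_deviation:
  fixes B :: "'i \<Rightarrow> 'a \<Rightarrow> real" and p :: real
  assumes "finite I" and indep: "indep_vars (\<lambda>_. borel) B I"
    and B01: "\<And>i \<omega>. i \<in> I \<Longrightarrow> B i \<omega> \<in> {0, 1}"
    and EB: "\<And>i. i \<in> I \<Longrightarrow> expectation (B i) = p"
    and p: "0 \<le> p" "p \<le> 1"
  defines "m \<equiv> card I * p"
  shows "expectation (\<lambda>\<omega>. \<bar>(\<Sum>i\<in>I. B i \<omega>) - m\<bar>) \<ge> 2 * m * (1 - p) ^ card I"
    and "m \<ge> 1 \<Longrightarrow> expectation (\<lambda>\<omega>. \<bar>(\<Sum>i\<in>I. B i \<omega>) - m\<bar>) \<ge> sqrt m * (1 / 2 - 3 * p / 4)"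
proof -
  define S where "S = (\<lambda>\<omega>. (\<Sum>i\<in>I. B i \<omega>) - m)"
  have mB: "\<And>i. i \<in> I \<Longrightarrow> random_variable borel (B i)"
    using indep by (simp add: indep_vars_def)
  have Bb: "0 \<le> B i \<omega>" "B i \<omega> \<le> 1" if "i \<in> I" for i \<omega>
    using B01[OF that, of \<omega>] by auto
  have iB: "integrable M (B i)" if "i \<in> I" for i
    using Bb[OF that] mB[OF that] by (intro bounded_integrable[where c = 1]) auto
  have mS[measurable]: "random_variable borel S"
    using mB unfolding S_def by simp
  have S_bound: "\<bar>S \<omega>\<bar> \<le> card I" for \<omega>
  proof -
    have "0 \<le> (\<Sum>i\<in>I. B i \<omega>)" using Bb by (intro sum_nonneg)
    moreover have "(\<Sum>i\<in>I. B i \<omega>) \<le> (\<Sum>i\<in>I. 1)" using Bb by (intro sum_mono)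
    moreover have "0 \<le> m" "m \<le> card I" using p by (auto simp: m_def mult_left_le)
    ultimately show ?thesis by (simp add: S_def)
  qed
  have iS: "integrable M (\<lambda>\<omega>. S \<omega> ^ b)" for b
    using S_bound by (intro bounded_integrable[where c = "card I ^ b"]) (auto simp: power_abs power_mono)
  have iabs: "integrable M (\<lambda>\<omega>. \<bar>S \<omega>\<bar>)"
    using iS[of 1] by simp
  have ES: "expectation S = 0"
    unfolding S_def using iB EB by (simp add: m_def prob_space)
  have indep': "indep_vars (\<lambda>_. borel) (\<lambda>i \<omega>. 1 - B i \<omega>) I"
    using indep_vars_compose2[OF indep, of "\<lambda>_ x. 1 - x" "\<lambda>_. borel"] by simp
  have i1: "\<And>i. i \<in> I \<Longrightarrow> integrable M (\<lambda>\<omega>. 1 - B i \<omega>)"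
    using iB by simp
  \<comment> \<open>\<open>?Q\<close> is the indicator of the event that all \<open>B i\<close>
    vanish, written as a product so that independence gives its expectation.\<close>
  let ?Q = "\<lambda>\<omega>. \<Prod>i\<in>I. 1 - B i \<omega>"
  have iQ: "integrable M ?Q"
    using indep_vars_integrable[OF \<open>finite I\<close> indep' i1] by simp
  have "expectation ?Q = (\<Prod>i\<in>I. expectation (\<lambda>\<omega>. 1 - B i \<omega>))"
    using indep_vars_lebesgue_integral[OF \<open>finite I\<close> indep' i1] by simp
  also have "\<dots> = (\<Prod>i\<in>I. 1 - p)"
    using iB EB by (intro prod.cong) (auto simp: prob_space)
  finally have EQ: "expectation ?Q = (1 - p) ^ card I" by simp
  have "2 * m * (1 - p) ^ card I = expectation (\<lambda>\<omega>. S \<omega> + 2 * m * ?Q \<omega>)"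
    using iS[of 1] iQ ES EQ by simp
  \<comment> \<open>Pointwise: if all \<open>B i\<close> vanish, then
    \<open>S \<omega> = - m\<close> and both sides equal \<open>m\<close>; otherwise
    \<open>?Q \<omega> = 0\<close> and the claim is
    \<open>S \<omega> \<le> \<bar>S \<omega>\<bar>\<close>.\<close>
  also have "\<dots> \<le> expectation (\<lambda>\<omega>. \<bar>S \<omega>\<bar>)"
  proof (rule integral_mono[OF _ iabs])
    show "integrable M (\<lambda>\<omega>. S \<omega> + 2 * m * ?Q \<omega>)" using iS[of 1] iQ by simp
    fix \<omega>
    show "S \<omega> + 2 * m * ?Q \<omega> \<le> \<bar>S \<omega>\<bar>"
    proof (cases "\<forall>i\<in>I. B i \<omega> = 0")
      case True
      then show ?thesis using p by (simp add: S_def m_def)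
    next
      case False
      then have "?Q \<omega> = 0" using B01 \<open>finite I\<close> by (metis (no_types, lifting) insertE singletonD prod_zero right_minus_eq)
      then show ?thesis by simp
    qed
  qed
  finally show "expectation (\<lambda>\<omega>. \<bar>(\<Sum>i\<in>I. B i \<omega>) - m\<bar>) \<ge> 2 * m * (1 - p) ^ card I"
    by (simp add: S_def)

  assume m: "m \<ge> 1"
  have S_eq: "(\<Sum>i\<in>I. B i \<omega> - p) = S \<omega>" for \<omega>
    by (simp add: S_def m_def sum_subtractf)
  have "expectation (\<lambda>\<omega>. (B i \<omega> - p)\<^sup>2) = p * (1 - p)" if "i \<in> I" for i
  proof -
    \<comment> \<open>Linear in \<open>B i \<omega>\<close> because a variable with values 0 and 1
      equals its square.\<close>
    have "(B i \<omega> - p)\<^sup>2 = (1 - 2 * p) * B i \<omega> + p\<^sup>2" for \<omega>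
      using B01[OF that, of \<omega>] by (auto simp: power2_eq_square algebra_simps)
    then have "expectation (\<lambda>\<omega>. (B i \<omega> - p)\<^sup>2) = (1 - 2 * p) * p + p\<^sup>2"
      using iB[OF that] EB[OF that] by (simp add: prob_space)
    then show ?thesis by (simp add: power2_eq_square algebra_simps)
  qed
  moreover have "indep_vars (\<lambda>_. borel) (\<lambda>i \<omega>. B i \<omega> - p) I"
    using indep_vars_compose2[OF indep, of "\<lambda>_ x. x - p" "\<lambda>_. borel"] by simp
  moreover have "\<bar>B i \<omega> - p\<bar> \<le> 1" if "i \<in> I" for i \<omega>
    using Bb[OF that, of \<omega>] p by auto
  moreover have "expectation (\<lambda>\<omega>. B i \<omega> - p) = 0" if "i \<in> I" for i
    using iB[OF that] EB[OF that] by (simp add: prob_space)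
  ultimately have mom: "expectation (\<lambda>\<omega>. S \<omega> ^ 2) = m * (1 - p)"
    "expectation (\<lambda>\<omega>. S \<omega> ^ 4) \<le> 3 * (m * (1 - p)) ^ 2 + m * (1 - p)"
    using moments_sum_centered[OF \<open>finite I\<close>, of "\<lambda>i \<omega>. B i \<omega> - p" "p * (1 - p)"]
    by (auto simp: S_eq m_def mult.assoc)
  have a: "m * (1 - p) \<le> m" using m p by (simp add: mult_left_le)
  then have "(m * (1 - p)) ^ 2 \<le> m\<^sup>2" using m p by (intro power_mono) auto
  \<comment> \<open>Here \<open>m \<ge> 1\<close> lets the linear term of the fourth moment be
    absorbed, giving the constant 3 + 1 = 4.\<close>
  moreover have "m \<le> m\<^sup>2" using m by (simp add: power2_eq_square)
  ultimately have m4: "expectation (\<lambda>\<omega>. S \<omega> ^ 4) \<le> 4 * m\<^sup>2" using mom(2) a by linarith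
  define r where "r = sqrt m"
  have r: "r > 0" "r\<^sup>2 = m" using m by (auto simp: r_def)
  \<comment> \<open>With second moment about \<open>m\<close> and fourth moment at most
    \<open>4 * m ^ 2\<close>, the quartic bound is
    \<open>3 * m / (2 * t) - 2 * m ^ 2 / t ^ 3\<close>, which is largest at
    \<open>t = 2 * sqrt m\<close>.\<close>
  let ?t = "2 * r"
  have "r * (1 / 2 - 3 * p / 4) = 3 * (m * (1 - p)) / (2 * ?t) - 4 * m\<^sup>2 / (2 * ?t ^ 3)"
    using r(1) unfolding r(2)[symmetric] by (simp add: field_simps power2_eq_square power3_eq_cube)
  also have "\<dots> \<le> 3 * expectation (\<lambda>\<omega>. S \<omega> ^ 2) / (2 * ?t) - expectation (\<lambda>\<omega>. S \<omega> ^ 4) / (2 * ?t ^ 3)"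
    using m4 r(1) mom(1) by (intro diff_mono divide_right_mono) auto
  also have "\<dots> = expectation (\<lambda>\<omega>. 3 * S \<omega> ^ 2 / (2 * ?t) - S \<omega> ^ 4 / (2 * ?t ^ 3))"
    using iS[of 2] iS[of 4] by simp
  also have "\<dots> \<le> expectation (\<lambda>\<omega>. \<bar>S \<omega>\<bar>)"
    using iS[of 2] iS[of 4] iabs r(1) abs_ge_quartic[of ?t] by (intro integral_mono) auto
  finally show "expectation (\<lambda>\<omega>. \<bar>(\<Sum>i\<in>I. B i \<omega>) - m\<bar>) \<ge> sqrt m * (1 / 2 - 3 * p / 4)"
    by (simp add: S_def r_def)
qed

text \<open>The sequence is nondecreasing and starts with the value 1/4 at
  \<open>n = 2\<close>.\<close>

lemma one_minus_inverse_power_ge: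
  assumes "n \<ge> (2::nat)"
  shows "(1 - 1 / real n) ^ n \<ge> 1 / 4"
  using assms
proof (induction n rule: dec_induct)
  case base
  then show ?case by (simp add: power2_eq_square)
next
  case (step n)
  define x where "x = real n"
  have x: "x \<ge> 2" using step.hyps by (simp add: x_def)
  \<comment> \<open>\<open>y\<close> is the ratio of consecutive bases. Bernoulli's inequality gives
    \<open>y ^ n \<ge> 1 + 1 / x\<close>, and \<open>(1 + 1 / x) * (1 - 1 / (x + 1)) = 1\<close>, so
    the power does not decrease from \<open>n\<close> to \<open>Suc n\<close>.\<close>
  define y where "y = (1 - 1 / (x + 1)) / (1 - 1 / x)"
  have x2_eq: "x\<^sup>2 - 1 = (x - 1) * (x + 1)" by (simp add: power2_eq_square algebra_simps)
  have x2: "x\<^sup>2 - 1 > 0" unfolding x2_eq using x by simp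
  have "y = x\<^sup>2 / (x\<^sup>2 - 1)"
    unfolding x2_eq using x by (simp add: y_def field_simps power2_eq_square)
  also have "\<dots> = 1 + 1 / (x\<^sup>2 - 1)" using x2 by (simp add: field_simps)
  finally have y: "y = 1 + 1 / (x\<^sup>2 - 1)" .
  have "1 / x \<le> x * (1 / (x\<^sup>2 - 1))"
    using x x2 by (simp add: field_simps power2_eq_square)
  then have "1 + 1 / x \<le> 1 + n * (1 / (x\<^sup>2 - 1))" by (simp add: x_def)
  also have "\<dots> \<le> y ^ n"
    unfolding y using x2 by (intro Bernoulli_inequality) (auto intro: order_trans[of _ 0])
  finally have "(1 + 1 / x) * (1 - 1 / (x + 1)) \<le> y ^ n * (1 - 1 / (x + 1))"
    using x by (intro mult_right_mono) auto
  moreover have "(1 + 1 / x) * (1 - 1 / (x + 1)) = ((x + 1) / x) * (x / (x + 1))"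
    using x by (intro arg_cong2[where f = "(*)"]) (simp_all add: field_simps)
  ultimately have "1 \<le> y ^ n * (1 - 1 / (x + 1))" using x by simp
  then have "(1 - 1 / x) ^ n * 1 \<le> (1 - 1 / x) ^ n * (y ^ n * (1 - 1 / (x + 1)))"
    using x by (intro mult_left_mono) auto
  also have "\<dots> = ((1 - 1 / x) * y) ^ n * (1 - 1 / (x + 1))"
    by (simp add: power_mult_distrib)
  also have "(1 - 1 / x) * y = 1 - 1 / (x + 1)" using x by (simp add: y_def)
  finally show ?case using step.IH by (simp add: x_def add_ac mult_ac)
qed

text \<open>Shifts the index set \<open>{1..}\<close> to all of \<open>nat\<close>, the form in
  which sum and integral are interchanged later.\<close>

lemma sums_from_1:
  fixes f :: "nat \<Rightarrow> real"
  assumes "f summable_on {1..}"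
  shows "(\<lambda>k. f (Suc k)) sums infsum f {1..}"
proof -
  have "(f has_sum infsum f {1..}) {1..}" using assms by (rule has_sum_infsum)
  moreover have "{1..} = range Suc"
    by (auto simp: image_iff) (metis Suc_le_D)
  ultimately have "((\<lambda>k. f (Suc k)) has_sum infsum f {1..}) UNIV"
    by (simp add: has_sum_reindex comp_def)
  then show ?thesis by (rule has_sum_imp_sums)
qed

section \<open>The i.i.d. sample and its empirical frequencies\<close>

locale iid_sample = prob_space M for M :: "'a measure" +
  fixes n :: nat and p :: "nat \<Rightarrow> real" and X :: "nat \<Rightarrow> 'a \<Rightarrow> nat"
  assumes n: "n \<ge> 2"
    and p: "distribution p"
    and indep: "indep_vars (\<lambda>_. count_space {1..}) X {1..n}"
    and distr: "\<And>i. i \<in> {1..n} \<Longrightarrow> distributed M (count_space {1..}) (X i) (\<lambda>j. ennreal (p j))"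
begin

text \<open>With \<open>j\<close> as first argument, \<open>hit j\<close> is the family of Bernoulli
  variables whose sum is the count of \<open>j\<close>.\<close>

definition hit :: "nat \<Rightarrow> nat \<Rightarrow> 'a \<Rightarrow> real" where
  "hit j i \<omega> = indicator {\<omega>'. X i \<omega>' = j} \<omega>"

lemma emp_freq_hit: "emp_freq n X \<omega> j = (\<Sum>i=1..n. hit j i \<omega>) / n"
  by (simp add: emp_freq_def hit_def)

lemma hit_01: "hit j i \<omega> \<in> {0, 1}"
  by (simp add: hit_def indicator_def)

lemma p_summable: "p summable_on {1..}" and p_infsum: "infsum p {1..} = 1"
  and p_nonneg: "j \<ge> 1 \<Longrightarrow> p j \<ge> 0"
  using p by (auto simp: distribution_def summable_on_def intro: infsumI)

lemma p_le_1: assumes "j \<ge> 1" shows "p j \<le> 1"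
proof -
  have "infsum p {j} \<le> infsum p {1..}"
    using assms p_summable p_nonneg by (intro infsum_mono_neutral) auto
  then show ?thesis unfolding p_infsum by simp
qed

lemma hit_measurable: "i \<in> {1..n} \<Longrightarrow> random_variable borel (hit j i)"
proof -
  assume "i \<in> {1..n}"
  then have "random_variable (count_space {1..}) (X i)"
    using indep by (simp add: indep_vars_def)
  then have "random_variable borel (\<lambda>\<omega>. indicat_real {j} (X i \<omega>))"
    by (rule measurable_compose) simp
  moreover have "hit j i = (\<lambda>\<omega>. indicat_real {j} (X i \<omega>))"
    by (auto simp: hit_def fun_eq_iff indicator_def)
  ultimately show ?thesis by simp
qed

lemma hit_indep: "indep_vars (\<lambda>_. borel) (hit j) {1..n}"
proof -
  have "hit j = (\<lambda>i \<omega>. indicat_real {j} (X i \<omega>))"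
    by (auto simp: hit_def fun_eq_iff indicator_def)
  then show ?thesis
    using indep_vars_compose2[OF indep, of "\<lambda>_. indicat_real {j}" "\<lambda>_. borel"] by simp
qed

lemma hit_expectation:
  assumes "i \<in> {1..n}" "j \<ge> 1"
  shows "expectation (hit j i) = p j"
proof -
  have "emeasure M (X i -` {j} \<inter> space M) =
    (\<integral>\<^sup>+x. ennreal (p x) * indicator {j} x \<partial>count_space {1..})"
    using assms by (intro distributed_emeasure[OF distr]) auto
  also have "\<dots> = ennreal (p j)"
    using assms by (subst nn_integral_indicator_singleton) auto
  finally have "prob (X i -` {j} \<inter> space M) = p j"
    using p_nonneg[OF assms(2)] by (simp add: measure_def)
  \<comment> \<open>The two indicators may differ outside \<open>space M\<close>, which the integral
    does not see.\<close>
  moreover have "expectation (hit j i) = expectation (indicat_real (X i -` {j} \<inter> space M))"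
    by (intro Bochner_Integration.integral_cong) (auto simp: hit_def indicator_def)
  moreover have "expectation (indicat_real (X i -` {j} \<inter> space M)) = prob (X i -` {j} \<inter> space M)"
    by simp
  ultimately show ?thesis by simp
qed

lemma emp_freq_nonneg: "emp_freq n X \<omega> j \<ge> 0"
  by (auto simp: emp_freq_def intro!: sum_nonneg divide_nonneg_nonneg)

lemma emp_freq_measurable [measurable]: "random_variable borel (\<lambda>\<omega>. emp_freq n X \<omega> j)"
  using hit_measurable by (simp add: emp_freq_hit)

lemma emp_freq_le_1: "emp_freq n X \<omega> j \<le> 1"
proof -
  have "(\<Sum>i=1..n. hit j i \<omega>) \<le> (\<Sum>i=1..n. 1)"
    using hit_01 by (intro sum_mono) (metis insertE order_refl singletonD zero_le_one)
  then show ?thesis using n by (simp add: emp_freq_hit)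
qed

lemma emp_freq_integrable: "integrable M (\<lambda>\<omega>. emp_freq n X \<omega> j)"
  using emp_freq_nonneg emp_freq_le_1 by (intro bounded_integrable[where c = 1]) auto

lemma emp_freq_expectation: "j \<ge> 1 \<Longrightarrow> expectation (\<lambda>\<omega>. emp_freq n X \<omega> j) = p j"
proof -
  assume j: "j \<ge> 1"
  have "integrable M (hit j i)" if "i \<in> {1..n}" for i
    using hit_01[of j i] hit_measurable[OF that]
    by (intro bounded_integrable[where c = 1]) (auto simp: hit_def indicator_def)
  then show ?thesis using n j hit_expectation by (simp add: emp_freq_hit)
qed

section \<open>Expected deviation at a single point\<close>

lemma deviation_integrable: "integrable M (\<lambda>\<omega>. \<bar>emp_freq n X \<omega> j - p j\<bar>)"
  using emp_freq_integrable by simp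

text \<open>From the triangle inequality and the mean \<open>p j\<close> of the frequency. It
  provides the summable majorant for interchanging expectation and sum.\<close>

lemma deviation_expectation_le:
  assumes "j \<ge> 1"
  shows "expectation (\<lambda>\<omega>. \<bar>emp_freq n X \<omega> j - p j\<bar>) \<le> 2 * p j"
proof -
  have "expectation (\<lambda>\<omega>. \<bar>emp_freq n X \<omega> j - p j\<bar>) \<le> expectation (\<lambda>\<omega>. emp_freq n X \<omega> j + p j)"
    using deviation_integrable emp_freq_integrable emp_freq_nonneg p_nonneg[OF assms]
    by (intro integral_mono) (auto simp: abs_le_iff)
  then show ?thesis
    using emp_freq_expectation[OF assms] emp_freq_integrable by (simp add: prob_space)
qed

lemma deviation_expectation_eq:
  "expectation (\<lambda>\<omega>. \<bar>emp_freq n X \<omega> j - p j\<bar>) =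
    expectation (\<lambda>\<omega>. \<bar>(\<Sum>i=1..n. hit j i \<omega>) - n * p j\<bar>) / n"
proof -
  have "\<bar>emp_freq n X \<omega> j - p j\<bar> = \<bar>(\<Sum>i=1..n. hit j i \<omega>) - n * p j\<bar> / n" for \<omega>
  proof -
    have "emp_freq n X \<omega> j - p j = ((\<Sum>i=1..n. hit j i \<omega>) - n * p j) / n"
      using n by (simp add: emp_freq_hit field_simps)
    then show ?thesis by (simp add: abs_divide)
  qed
  then show ?thesis by simp
qed

text \<open>Since \<open>p j < 1 / n\<close>, the probability \<open>(1 - p j) ^ n\<close> of never
  seeing \<open>j\<close> is at least \<open>(1 - 1 / n) ^ n\<close>, hence at least 1/4.\<close>

lemma deviation_ge_small:
  assumes "j \<ge> 1" "p j < 1 / n"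
  shows "expectation (\<lambda>\<omega>. \<bar>emp_freq n X \<omega> j - p j\<bar>) \<ge> p j / 2"
proof -
  have "1 / 4 \<le> (1 - 1 / real n) ^ n" using n by (rule one_minus_inverse_power_ge)
  also have "\<dots> \<le> (1 - p j) ^ n"
    using assms n by (intro power_mono) auto
  finally have "2 * p j * (1 / 4) \<le> 2 * p j * (1 - p j) ^ n"
    using p_nonneg[OF assms(1)] by (intro mult_left_mono) auto
  moreover have "2 * (n * p j) * (1 - p j) ^ n \<le> expectation (\<lambda>\<omega>. \<bar>(\<Sum>i=1..n. hit j i \<omega>) - n * p j\<bar>)"
    using Bernoulli_sum_abs_deviation(1)[OF _ hit_indep hit_01 hit_expectation] assms
      p_nonneg[OF assms(1)] p_le_1[OF assms(1)] by simp
  then have "2 * p j * (1 - p j) ^ n \<le> expectation (\<lambda>\<omega>. \<bar>(\<Sum>i=1..n. hit j i \<omega>) - n * p j\<bar>) / n"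
    using n by (simp add: field_simps)
  ultimately show ?thesis unfolding deviation_expectation_eq by linarith
qed

lemma deviation_ge_large:
  assumes "j \<ge> 1" "p j \<ge> 1 / n"
  shows "expectation (\<lambda>\<omega>. \<bar>emp_freq n X \<omega> j - p j\<bar>) \<ge> sqrt (p j) / (4 * sqrt n) - p j / sqrt n"
proof -
  define r s where "r = sqrt (p j)" and "s = sqrt (real n)"
  have s: "s > 0" "s\<^sup>2 = real n" using n by (auto simp: s_def)
  have r: "0 \<le> r" "r \<le> 1" "r\<^sup>2 = p j"
    using p_nonneg[OF assms(1)] p_le_1[OF assms(1)] by (auto simp: r_def)
  have "n * p j \<ge> 1" using assms n by (simp add: field_simps)
  then have "sqrt (n * p j) * (1 / 2 - 3 * p j / 4) \<le> expectation (\<lambda>\<omega>. \<bar>(\<Sum>i=1..n. hit j i \<omega>) - n * p j\<bar>)"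
    using Bernoulli_sum_abs_deviation(2)[OF _ hit_indep hit_01 hit_expectation] assms
      p_nonneg[OF assms(1)] p_le_1[OF assms(1)] by simp
  moreover have "sqrt (n * p j) = s * r" by (simp add: r_def s_def real_sqrt_mult)
  ultimately have "s * r * (1 / 2 - 3 * r\<^sup>2 / 4) / n \<le> expectation (\<lambda>\<omega>. \<bar>(\<Sum>i=1..n. hit j i \<omega>) - n * p j\<bar>) / n"
    by (simp add: r(3) divide_right_mono)
  moreover have "s * r * (1 / 2 - 3 * r\<^sup>2 / 4) / n = r * (1 / 2 - 3 * r\<^sup>2 / 4) / s"
    using s(1) unfolding s(2)[symmetric] by (simp add: field_simps power2_eq_square)
  \<comment> \<open>Since \<open>r\<close> lies between 0 and 1, \<open>r ^ 2 \<le> r\<close>. The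
    weaker factor turns the loss into \<open>r * r / s\<close>, that is \<open>p j / sqrt n\<close>,
    whose sum over \<open>j\<close> is controlled by the total mass.\<close>
  moreover have "r * (1 / 4 - r) / s \<le> r * (1 / 2 - 3 * r\<^sup>2 / 4) / s"
  proof -
    have "r\<^sup>2 \<le> r" using r(1,2) by (simp add: power2_eq_square mult_left_le)
    then have "1 / 4 - r \<le> 1 / 2 - 3 * r\<^sup>2 / 4" using r by simp
    then show ?thesis using r s by (intro divide_right_mono mult_left_mono) auto
  qed
  moreover have "r * (1 / 4 - r) / s = sqrt (p j) / (4 * sqrt n) - p j / sqrt n"
    using s(1) r(1) unfolding r(3)[symmetric] r_def[symmetric] s_def[symmetric]
    by (simp add: field_simps power2_eq_square)
  ultimately show ?thesis unfolding deviation_expectation_eq by linarith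
qed

section \<open>Summation over all points\<close>

lemma emp_freq_summable: "(\<lambda>j. emp_freq n X \<omega> j) summable_on {1..}"
\<comment> \<open>For a fixed outcome only the finitely many observed values have nonzero
  frequency.\<close>
proof (rule summable_on_cong_neutral[THEN iffD1])
  show "(\<lambda>j. emp_freq n X \<omega> j) summable_on ((\<lambda>i. X i \<omega>) ` {1..n} \<inter> {1..})"
    by (intro summable_on_finite) auto
  show "emp_freq n X \<omega> j = 0" if "j \<in> {1..} - ((\<lambda>i. X i \<omega>) ` {1..n} \<inter> {1..})" for j
    using that by (auto simp: emp_freq_def indicator_def intro!: sum.neutral)
qed auto

lemma deviation_summable: "(\<lambda>j. \<bar>emp_freq n X \<omega> j - p j\<bar>) summable_on {1..}"
proof (rule summable_on_comparison_test[OF summable_on_add[OF emp_freq_summable p_summable]])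
  fix j :: nat assume "j \<in> {1..}"
  then show "\<bar>emp_freq n X \<omega> j - p j\<bar> \<le> emp_freq n X \<omega> j + p j"
    using emp_freq_nonneg[of \<omega> j] p_nonneg[of j] by auto
qed auto

lemma summable_expected_deviation:
  "(\<lambda>j. expectation (\<lambda>\<omega>. \<bar>emp_freq n X \<omega> j - p j\<bar>)) summable_on {1..}"
  using deviation_expectation_le
  by (intro summable_on_comparison_test[OF summable_on_cmult_right[OF p_summable, of 2]]) auto

text \<open>The interchange rests on summability of the deviations at each outcome and on
  summability of their expectations.\<close>

lemma expectation_J:
  "expectation (J n p X) = (\<Sum>\<^sub>\<infinity>j\<in>{1..}. expectation (\<lambda>\<omega>. \<bar>emp_freq n X \<omega> j - p j\<bar>))"
proof -
  let ?g = "\<lambda>k \<omega>. \<bar>emp_freq n X \<omega> (Suc k) - p (Suc k)\<bar>"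
  note sm = sums_from_1[OF summable_expected_deviation]
  have "J n p X = (\<lambda>\<omega>. \<Sum>k. ?g k \<omega>)"
    unfolding J_def by (intro ext sums_unique[OF sums_from_1[OF deviation_summable]])
  then have "expectation (J n p X) = expectation (\<lambda>\<omega>. \<Sum>k. ?g k \<omega>)" by (rule arg_cong)
  also have "\<dots> = (\<Sum>k. expectation (?g k))"
    using sums_summable[OF sums_from_1[OF deviation_summable]] sums_summable[OF sm]
      deviation_integrable by (intro integral_suminf) auto
  finally show ?thesis using sums_unique[OF sm] by simp
qed

lemma expectation_J_ge:
  "expectation (J n p X) \<ge> (alpha n p + beta n p) / 4 - 1 / sqrt n"
proof -
  let ?E = "\<lambda>j. expectation (\<lambda>\<omega>. \<bar>emp_freq n X \<omega> j - p j\<bar>)"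
  let ?A = "{j\<in>{1..}. p j < 1 / real n}" and ?B = "{j\<in>{1..}. p j \<ge> 1 / real n}"
  have AB: "{1..} = ?A \<union> ?B" "?A \<inter> ?B = {}" by auto
  have pA: "p summable_on ?A" and pB: "p summable_on ?B"
    using p_summable by (auto intro: summable_on_subset_banach)
  have EA: "?E summable_on ?A" and EB: "?E summable_on ?B"
    using summable_expected_deviation by (auto intro: summable_on_subset_banach)
  \<comment> \<open>On \<open>?B\<close> one has \<open>1 \<le> sqrt (n * p j)\<close>, so
    \<open>sqrt n * p j\<close> is a majorant. Thus the infinite sum in \<open>beta\<close> is a
    genuine one and not the default value 0.\<close>
  have sB: "(\<lambda>j. sqrt (p j)) summable_on ?B"
  proof (rule summable_on_comparison_test[OF summable_on_cmult_right[OF pB, of "sqrt n"]])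
    fix j assume j: "j \<in> ?B"
    then have "1 \<le> n * p j" using n by (simp add: field_simps)
    then have "1 \<le> sqrt n * sqrt (p j)" by (simp flip: real_sqrt_mult)
    then have "sqrt (p j) * 1 \<le> sqrt (p j) * (sqrt n * sqrt (p j))"
      using j p_nonneg[of j] by (intro mult_left_mono) auto
    also have "\<dots> = sqrt n * p j" using j p_nonneg[of j] by simp
    finally show "sqrt (p j) \<le> sqrt n * p j" by simp
  qed (use p_nonneg in auto)
  \<comment> \<open>The factor 2 in \<open>alpha\<close> makes a quarter of it the sum of the lower
    bounds \<open>p j / 2\<close>.\<close>
  have "alpha n p / 4 = (\<Sum>\<^sub>\<infinity>j\<in>?A. 1 / 2 * p j)"
    unfolding alpha_def by (subst infsum_cmult_right') simp
  also have "\<dots> \<le> infsum ?E ?A"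
    using deviation_ge_small pA EA by (intro infsum_mono summable_on_cmult_right) auto
  finally have A: "alpha n p / 4 \<le> infsum ?E ?A" .
  have pB1: "infsum p ?B \<le> 1"
    using infsum_mono_neutral[OF pB p_summable] p_nonneg p_infsum by auto
  have "beta n p / 4 = (\<Sum>\<^sub>\<infinity>j\<in>?B. 1 / (4 * sqrt n) * sqrt (p j))"
    unfolding beta_def by (subst infsum_cmult_right') simp
  \<comment> \<open>The losses are moved to the right side; they add up to
    \<open>infsum p ?B / sqrt n\<close>, and the mass of \<open>?B\<close> is at most 1.\<close>
  also have "\<dots> \<le> (\<Sum>\<^sub>\<infinity>j\<in>?B. ?E j + 1 / sqrt n * p j)"
  proof (intro infsum_mono summable_on_cmult_right summable_on_add sB EB pB)
    fix j assume "j \<in> ?B"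
    then show "1 / (4 * sqrt n) * sqrt (p j) \<le> ?E j + 1 / sqrt n * p j"
      using deviation_ge_large[of j] by simp
  qed
  also have "\<dots> = infsum ?E ?B + 1 / sqrt n * infsum p ?B"
    by (simp only: infsum_add[OF EB summable_on_cmult_right[OF pB]] infsum_cmult_right')
  also have "\<dots> \<le> infsum ?E ?B + 1 / sqrt n * 1"
    using pB1 n by (intro add_left_mono mult_left_mono) auto
  finally have B: "beta n p / 4 - 1 / sqrt n \<le> infsum ?E ?B" by simp
  have "infsum ?E {1..} = infsum ?E ?A + infsum ?E ?B"
    by (subst AB(1), rule infsum_Un_disjoint[OF EA EB AB(2)])
  then show ?thesis
    using A B unfolding expectation_J add_divide_distrib by linarith
qed

end

theorem proposition2p4:
  fixes n :: nat and p :: "nat \<Rightarrow> real"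
    and M :: "'a measure" and X :: "nat \<Rightarrow> 'a \<Rightarrow> nat"
  assumes "n \<ge> 2"
    and "distribution p"
    and "prob_space M"
    and "prob_space.indep_vars M (\<lambda>_. count_space {1..}) X {1..n}"
    and "\<And>i. i \<in> {1..n} \<Longrightarrow> distributed M (count_space {1..}) (X i) (\<lambda>j. ennreal (p j))"
  shows "prob_space.expectation M (J n p X) \<ge> (alpha n p + beta n p) / 4 - 1 / sqrt (real n)"
proof -
  interpret iid_sample M n p X
    using assms by (simp add: iid_sample_def iid_sample_axioms_def)
  show ?thesis by (rule expectation_J_ge)
qed

end
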